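(* For every reactive Turing machine $M=(S,\to,\uparrow,\downarrow)$, $\mathcal{T}(M)\leftrightarrow_b^\Delta\mathcal{T}_{E_{fc}\cup E_T^\infty}([C_{\uparrow,\Box}\parallel T_{\check\Box}]_{\{r,w,m\}})$.
   Context: Fix a finite set $\mathcal{A}$ of actions, $\tau\notin\mathcal{A}$, $\mathcal{A}_\tau=\mathcal{A}\cup\{\tau\}$, a finite data set $\mathcal{D}$ with blank $\Box\notin\mathcal{D}$, $\mathcal{D}_\Box=\mathcal{D}\cup\{\Box\}$; channels $r,w,m$ carry values in $\mathcal{D}_\Box\cup\{L,R\}$, and the actions of $M$ are not communication actions on $r,w,m$. RTM: $M=(S,\to,\uparrow,\downarrow)$ with $S$ finite, $\uparrow\in S$, $\downarrow\subseteq S$, $\to\subseteq S\times\mathcal{D}_\Box\times\mathcal{A}_\tau\times\mathcal{D}_\Box\times\{L,R\}\times S$. Tape instances: finite sequences over $\mathcal{D}_\Box$ and marked symbols $\check d$ with exactly one marked symbol, identified modulo blanks at the ends; for $\delta\in\mathcal{D}_\Box^*$, $\overleftarrow{\delta}$ (resp. $\overrightarrow{\delta}$) marks its rightmost (resp. leftmost) symbol, or is $\check\Box$ if $\delta$ is empty. $\mathcal{T}(M)$ has states $(s,\delta)$, transitions $(s,\delta_L\check d\delta_R)\xrightarrow{a}(t,\overleftarrow{\delta_L}e\delta_R)$ iff $(s,d,a,e,L,t)\in\to$ and $(s,\delta_L\check d\delta_R)\xrightarrow{a}(t,\delta_Le\overrightarrow{\delta_R})$ iff $(s,d,a,e,R,t)\in\to$,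 initial state $(\uparrow,\check\Box)$, final states $\{(s,\delta)\mid s\in\downarrow\}$. Process calculus: for channels $C'$, $I_{C'}=\{c?v,c!v\mid c\in C'\}$. Expressions $p::=0\mid 1\mid a.p\mid p+p\mid[p\parallel p]_{C'}\mid X$; recursive specifications $E$ are sets of equations $X\stackrel{def}{=}p$ (one per name, all used names defined). Rules ($p\downarrow$ = termination): $1\downarrow$; $a.p\xrightarrow{a}p$; $p+q$ has the transitions of $p$ and $q$ and terminates if either does; $[p\parallel q]_{C'}\xrightarrow{a}[p'\parallel q]_{C'}$ if $p\xrightarrow{a}p'$, $a\notin I_{C'}$, and symmetrically; $[p\parallel q]_{C'}\xrightarrow{\tau}[p'\parallel q']_{C'}$ if for some $c\in C'$ and $v$, $p\xrightarrow{c?v}p'$, $q\xrightarrow{c!v}q'$ or vice versa; $[p\parallel q]_{C'}\downarrow$ iff both terminate; names behave as their right-hand sides. $\mathcal{T}_E(p)$: expressions reachable from $p$, initial $p$, final those $q$ with $q\downarrow$. Tape $E_T^\infty$: $T_{\delta_L\check d\delta_R}\stackrel{def}{=}r!d.T_{\delta_L\check d\delta_R}+\sum_{e\in\mathcal{D}_\Box}w?e.T_{\delta_L\check e\delta_R}+m?L.T_{\overleftarrow{\delta_L}d\delta_R}+m?R.T_{\delta_Ld\overrightarrow{\delta_R}}+1$ for all $d,\delta_L,\delta_R$. Finite control $E_{fc}$: for all $s\in S$, $d\in\mathcal{D}_\Box$: $C_{s,d}\stackrel{def}{=}\sum_{(s,d,a,e,X,t)\in\to}a.w!e.m!X.\sum_{f\in\mathcal{D}_\Box}r?f.C_{t,f}$,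 with an additional summand $+1$ iff $s\in\downarrow$. Divergence-preserving branching bisimilarity $\leftrightarrow_b^\Delta$: write $s\xrightarrow{(a)}t$ if $s\xrightarrow{a}t$ or ($a=\tau$ and $s=t$); $\twoheadrightarrow$ / $\twoheadrightarrow^+$ are reflexive-transitive / transitive closures of $\xrightarrow{\tau}$. A relation $\mathcal{R}$ is a divergence-preserving branching bisimulation if $s_1\mathcal{R}s_2$ implies: (1) $s_1\xrightarrow{a}s_1'$ gives $s_2\twoheadrightarrow s_2''\xrightarrow{(a)}s_2'$ with $s_1\mathcal{R}s_2''$, $s_1'\mathcal{R}s_2'$; (2) symmetrically; (3) if $s_1$ final then $s_2\twoheadrightarrow s_2'$ final with $s_1\mathcal{R}s_2'$; (4) symmetrically; (5) an infinite $\tau$-sequence from $s_1$ with all states related to $s_2$ gives $s_2\twoheadrightarrow^+s_2'$ with $s_2'$ related to some state of the sequence; (6) symmetrically. Two transition systems are $\leftrightarrow_b^\Delta$ if such a relation relates their initial states. *)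

theory Defs
  imports Main
begin

datatype ('a, 'c, 'v) action = Tau | Act 'a | Recv 'c 'v | Send 'c 'v

record ('st, 'l) lts =
  states :: "'st set"
  trans  :: "('st \<times> 'l \<times> 'st) set"
  init   :: 'st
  final  :: "'st set"

type_synonym ('st, 'a, 'c, 'v) alts = "('st, ('a, 'c, 'v) action) lts"

definition tau_rel :: "('st, 'a, 'c, 'v) alts \<Rightarrow> ('st \<times> 'st) set" where
  "tau_rel T = {(s, t). (s, Tau, t) \<in> trans T}"

definition opt_step :: "('st, 'a, 'c, 'v) alts \<Rightarrow> 'st \<Rightarrow> ('a, 'c, 'v) action \<Rightarrow> 'st \<Rightarrow> bool" where
  "opt_step T s a t \<longleftrightarrow> (s, a, t) \<in> trans T \<or> (a = Tau \<and> s = t)"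

definition dpbb_half ::
  "('p, 'a, 'c, 'v) alts \<Rightarrow> ('q, 'a, 'c, 'v) alts \<Rightarrow> ('p \<times> 'q) set \<Rightarrow> bool" where
  "dpbb_half T1 T2 R \<longleftrightarrow> (\<forall>s1 s2. (s1, s2) \<in> R \<longrightarrow>
     (\<forall>a s1'. (s1, a, s1') \<in> trans T1 \<longrightarrow>
        (\<exists>s2'' s2'. (s2, s2'') \<in> (tau_rel T2)\<^sup>* \<and> opt_step T2 s2'' a s2' \<and>
                    (s1, s2'') \<in> R \<and> (s1', s2') \<in> R)) \<and>
     (s1 \<in> final T1 \<longrightarrow>
        (\<exists>s2'. (s2, s2') \<in> (tau_rel T2)\<^sup>* \<and> s2' \<in> final T2 \<and> (s1, s2') \<in> R)) \<and>
     (\<forall>f. f 0 = s1 \<and> (\<forall>i::nat. (f i, Tau, f (Suc i)) \<in> trans T1 \<and> (f i, s2) \<in> R) \<longrightarrow>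
        (\<exists>s2' i. (s2, s2') \<in> (tau_rel T2)\<^sup>+ \<and> (f i, s2') \<in> R)))"

definition dpbb ::
  "('p, 'a, 'c, 'v) alts \<Rightarrow> ('q, 'a, 'c, 'v) alts \<Rightarrow> ('p \<times> 'q) set \<Rightarrow> bool" where
  "dpbb T1 T2 R \<longleftrightarrow> R \<subseteq> states T1 \<times> states T2 \<and>
     dpbb_half T1 T2 R \<and> dpbb_half T2 T1 (R\<inverse>)"

definition dpbb_equiv ::
  "('p, 'a, 'c, 'v) alts \<Rightarrow> ('q, 'a, 'c, 'v) alts \<Rightarrow> bool"
  (infix \<open>\<leftrightarrow>\<^sub>b\<^sup>\<Delta>\<close> 50) where
  "T1 \<leftrightarrow>\<^sub>b\<^sup>\<Delta> T2 \<longleftrightarrow> (\<exists>R. dpbb T1 T2 R \<and> (init T1, init T2) \<in> R)"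

text \<open>The blank is \<^term>\<open>None\<close>. A triple \<open>(l, d, r)\<close> stands for the sequence \<open>l d r\<close> with the
  symbol \<open>d\<close> marked; both \<open>l\<close> and \<open>r\<close> are written from left to right.\<close>

type_synonym 'd raw_tape = "'d option list \<times> 'd option \<times> 'd option list"

definition with_blank :: "'d set \<Rightarrow> 'd option set" where
  "with_blank D = insert None (Some ` D)"

fun blank_eq :: "'d raw_tape \<Rightarrow> 'd raw_tape \<Rightarrow> bool" where
  "blank_eq (l, d, r) (l', d', r') \<longleftrightarrow>
     (\<exists>i j. replicate i None @ l = replicate j None @ l') \<and>
     d = d' \<and>
     (\<exists>i j. r @ replicate i None = r' @ replicate j None)"

lemma pad_left_trans:
  assumes "replicate i x @ l = replicate j x @ l'" "replicate i' x @ l' = replicate j' x @ l''"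
  shows "\<exists>i j. replicate i x @ l = replicate j x @ l''"
proof (intro exI)
  have "replicate (i' + i) x @ l = replicate (i' + j) x @ l'"
    using assms(1) by (simp add: replicate_add)
  also have "\<dots> = replicate (j + i') x @ l'" by (simp add: add.commute)
  also have "\<dots> = replicate (j + j') x @ l''"
    using assms(2) by (simp add: replicate_add)
  finally show "replicate (i' + i) x @ l = replicate (j + j') x @ l''" .
qed

lemma pad_right_trans:
  assumes "r @ replicate i x = r' @ replicate j x" "r' @ replicate i' x = r'' @ replicate j' x"
  shows "\<exists>i j. r @ replicate i x = r'' @ replicate j x"
proof (intro exI)
  have "r @ replicate (i + i') x = r' @ replicate (j + i') x"
    using assms(1) by (simp add: replicate_add flip: append_assoc)
  also have "\<dots> = r' @ replicate (i' + j) x" by (simp add: add.commute)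
  also have "\<dots> = r'' @ replicate (j' + j) x"
    using assms(2) by (simp add: replicate_add flip: append_assoc)
  finally show "r @ replicate (i + i') x = r'' @ replicate (j' + j) x" .
qed

lemma equivp_blank_eq: "equivp (blank_eq :: 'd raw_tape \<Rightarrow> _)"
proof (rule equivpI)
  show "reflp (blank_eq :: 'd raw_tape \<Rightarrow> _)" by (rule reflpI) (auto)
  show "symp (blank_eq :: 'd raw_tape \<Rightarrow> _)"
  proof (rule sympI)
    fix x y :: "'d raw_tape"
    assume "blank_eq x y"
    thus "blank_eq y x"
      by (cases x; cases y) (simp, metis)
  qed
  show "transp (blank_eq :: 'd raw_tape \<Rightarrow> _)"
  proof (rule transpI)
    fix x y z :: "'d raw_tape"
    assume "blank_eq x y" "blank_eq y z"
    thus "blank_eq x z"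
      by (cases x; cases y; cases z) (simp, blast intro: pad_left_trans pad_right_trans)
  qed
qed

quotient_type 'd tape = "'d raw_tape" / blank_eq
  by (rule equivp_blank_eq)

definition tape :: "'d option list \<Rightarrow> 'd option \<Rightarrow> 'd option list \<Rightarrow> 'd tape" where
  "tape l d r = abs_tape (l, d, r)"

definition tapes :: "'d set \<Rightarrow> 'd tape set" where
  "tapes D = {tape l d r | l d r.
     l \<in> lists (with_blank D) \<and> d \<in> with_blank D \<and> r \<in> lists (with_blank D)}"

text \<open>\<open>mark_last l r\<close> is the sequence \<open>l r\<close> with the mark on the rightmost symbol of \<open>l\<close>, a blank
  being inserted for an empty \<open>l\<close>; dually for \<open>mark_first l r\<close>, marking the leftmost symbol of
  \<open>r\<close>.\<close>

definition mark_last :: "'d option list \<Rightarrow> 'd option list \<Rightarrow> 'd tape" where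
  "mark_last l r = (if l = [] then tape [] None r else tape (butlast l) (last l) r)"

definition mark_first :: "'d option list \<Rightarrow> 'd option list \<Rightarrow> 'd tape" where
  "mark_first l r = (if r = [] then tape l None [] else tape l (hd r) (tl r))"

datatype dir = MoveL | MoveR

text \<open>The labels of a machine are drawn from the set \<open>insert Tau A\<close> for a set \<open>A\<close> of actions; \<open>A\<close> may
  itself contain communication actions.\<close>

record ('s, 'l, 'd) rtm =
  rtm_states :: "'s set"
  rtm_trans  :: "('s \<times> 'd option \<times> 'l \<times> 'd option \<times> dir \<times> 's) set"
  rtm_init   :: 's
  rtm_final  :: "'s set"

definition is_rtm ::
  "('a, 'c, 'v) action set \<Rightarrow> 'd set \<Rightarrow> ('s, ('a, 'c, 'v) action, 'd) rtm \<Rightarrow> bool" where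
  "is_rtm A D M \<longleftrightarrow>
     finite (rtm_states M) \<and> rtm_init M \<in> rtm_states M \<and> rtm_final M \<subseteq> rtm_states M \<and>
     rtm_trans M \<subseteq> rtm_states M \<times> with_blank D \<times> insert Tau A \<times> with_blank D \<times>
                    {MoveL, MoveR} \<times> rtm_states M"

definition rtm_lts :: "'d set \<Rightarrow> ('s, 'l, 'd) rtm \<Rightarrow> ('s \<times> 'd tape, 'l) lts" where
  "rtm_lts D M = \<lparr>
     states = rtm_states M \<times> tapes D,
     trans =
       {((s, tape l d r), a, (t, mark_last l (e # r))) | s l d r a t e.
          l \<in> lists (with_blank D) \<and> r \<in> lists (with_blank D) \<and>
          (s, d, a, e, MoveL, t) \<in> rtm_trans M} \<union>
       {((s, tape l d r), a, (t, mark_first (l @ [e]) r)) | s l d r a t e.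
          l \<in> lists (with_blank D) \<and> r \<in> lists (with_blank D) \<and>
          (s, d, a, e, MoveR, t) \<in> rtm_trans M},
     init = (rtm_init M, tape [] None []),
     final = rtm_final M \<times> tapes D\<rparr>"

definition comm_actions :: "'c set \<Rightarrow> ('a, 'c, 'v) action set" where
  "comm_actions C = {Recv c v | c v. c \<in> C} \<union> {Send c v | c v. c \<in> C}"

datatype ('n, 'a, 'c, 'v) proc =
    Zero
  | One
  | Prefix "('a, 'c, 'v) action" "('n, 'a, 'c, 'v) proc"
  | Plus "('n, 'a, 'c, 'v) proc" "('n, 'a, 'c, 'v) proc"
  | Par "'c set" "('n, 'a, 'c, 'v) proc" "('n, 'a, 'c, 'v) proc"
  | Name 'n

type_synonym ('n, 'a, 'c, 'v) spec = "('n \<times> ('n, 'a, 'c, 'v) proc) set"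

fun names :: "('n, 'a, 'c, 'v) proc \<Rightarrow> 'n set" where
  "names Zero = {}"
| "names One = {}"
| "names (Prefix a p) = names p"
| "names (Plus p q) = names p \<union> names q"
| "names (Par C p q) = names p \<union> names q"
| "names (Name X) = {X}"

definition recursive_spec :: "('n, 'a, 'c, 'v) spec \<Rightarrow> bool" where
  "recursive_spec E \<longleftrightarrow> single_valued E \<and> (\<forall>(X, p) \<in> E. names p \<subseteq> Domain E)"

inductive terminates :: "('n, 'a, 'c, 'v) spec \<Rightarrow> ('n, 'a, 'c, 'v) proc \<Rightarrow> bool"
  for E :: "('n, 'a, 'c, 'v) spec" where
  term_One: "terminates E One"
| term_PlusL: "terminates E p \<Longrightarrow> terminates E (Plus p q)"
| term_PlusR: "terminates E q \<Longrightarrow> terminates E (Plus p q)"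
| term_Par: "terminates E p \<Longrightarrow> terminates E q \<Longrightarrow> terminates E (Par C p q)"
| term_Name: "(X, p) \<in> E \<Longrightarrow> terminates E p \<Longrightarrow> terminates E (Name X)"

inductive step ::
  "('n, 'a, 'c, 'v) spec \<Rightarrow> ('n, 'a, 'c, 'v) proc \<Rightarrow> ('a, 'c, 'v) action \<Rightarrow>
   ('n, 'a, 'c, 'v) proc \<Rightarrow> bool"
  for E :: "('n, 'a, 'c, 'v) spec" where
  step_Prefix: "step E (Prefix a p) a p"
| step_PlusL: "step E p a p' \<Longrightarrow> step E (Plus p q) a p'"
| step_PlusR: "step E q a q' \<Longrightarrow> step E (Plus p q) a q'"
| step_ParL: "step E p a p' \<Longrightarrow> a \<notin> comm_actions C \<Longrightarrow> step E (Par C p q) a (Par C p' q)"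
| step_ParR: "step E q a q' \<Longrightarrow> a \<notin> comm_actions C \<Longrightarrow> step E (Par C p q) a (Par C p q')"
| step_CommL: "step E p (Recv c v) p' \<Longrightarrow> step E q (Send c v) q' \<Longrightarrow> c \<in> C \<Longrightarrow>
    step E (Par C p q) Tau (Par C p' q')"
| step_CommR: "step E p (Send c v) p' \<Longrightarrow> step E q (Recv c v) q' \<Longrightarrow> c \<in> C \<Longrightarrow>
    step E (Par C p q) Tau (Par C p' q')"
| step_Name: "(X, p) \<in> E \<Longrightarrow> step E p a p' \<Longrightarrow> step E (Name X) a p'"

definition reachable :: "('n, 'a, 'c, 'v) spec \<Rightarrow> ('n, 'a, 'c, 'v) proc \<Rightarrow>
    ('n, 'a, 'c, 'v) proc set" where
  "reachable E p = {q. (p, q) \<in> {(x, y). \<exists>a. step E x a y}\<^sup>*}"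

definition proc_lts :: "('n, 'a, 'c, 'v) spec \<Rightarrow> ('n, 'a, 'c, 'v) proc \<Rightarrow>
    (('n, 'a, 'c, 'v) proc, 'a, 'c, 'v) alts" where
  "proc_lts E p = \<lparr>
     states = reachable E p,
     trans = {(q, a, q'). q \<in> reachable E p \<and> step E q a q'},
     init = p,
     final = {q \<in> reachable E p. terminates E q}\<rparr>"

fun sum_list_proc :: "('n, 'a, 'c, 'v) proc list \<Rightarrow> ('n, 'a, 'c, 'v) proc" where
  "sum_list_proc [] = Zero"
| "sum_list_proc [p] = p"
| "sum_list_proc (p # q # ps) = Plus p (sum_list_proc (q # ps))"

text \<open>A finite sum lists its summands in an arbitrary but fixed order. This is only meaningful for
  finite index sets.\<close>

definition sum_proc :: "('i \<Rightarrow> ('n, 'a, 'c, 'v) proc) \<Rightarrow> 'i set \<Rightarrow> ('n, 'a, 'c, 'v) proc" where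
  "sum_proc f I = sum_list_proc (map f (SOME xs. distinct xs \<and> set xs = I))"

datatype 'c channel = Ch_r | Ch_w | Ch_m | Ch_other 'c

datatype 'd msg = Data "'d option" | Dir dir

datatype ('s, 'd) pname = Ctrl 's "'d option" | Tape "'d tape"

type_synonym ('s, 'a, 'c, 'd) mproc = "(('s, 'd) pname, 'a, 'c channel, 'd msg) proc"
type_synonym ('s, 'a, 'c, 'd) mspec = "(('s, 'd) pname, 'a, 'c channel, 'd msg) spec"
type_synonym ('a, 'c, 'd) maction = "('a, 'c channel, 'd msg) action"

definition tape_rhs :: "'d set \<Rightarrow> 'd option list \<Rightarrow> 'd option \<Rightarrow> 'd option list \<Rightarrow>
    ('s, 'a, 'c, 'd) mproc" where
  "tape_rhs D l d r =
     Plus (Plus (Plus (Plus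
       (Prefix (Send Ch_r (Data d)) (Name (Tape (tape l d r))))
       (sum_proc (\<lambda>e. Prefix (Recv Ch_w (Data e)) (Name (Tape (tape l e r)))) (with_blank D)))
       (Prefix (Recv Ch_m (Dir MoveL)) (Name (Tape (mark_last l (d # r))))))
       (Prefix (Recv Ch_m (Dir MoveR)) (Name (Tape (mark_first (l @ [d]) r)))))
       One"

definition E_tape :: "'d set \<Rightarrow> ('s, 'a, 'c, 'd) mspec" where
  "E_tape D = {(Tape (tape l d r), tape_rhs D l d r) | l d r.
     l \<in> lists (with_blank D) \<and> d \<in> with_blank D \<and> r \<in> lists (with_blank D)}"

definition ctrl_sum :: "'d set \<Rightarrow> ('s, ('a, 'c, 'd) maction, 'd) rtm \<Rightarrow> 's \<Rightarrow> 'd option \<Rightarrow>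
    ('s, 'a, 'c, 'd) mproc" where
  "ctrl_sum D M s d =
     sum_proc
       (\<lambda>(a, e, X, t). Prefix a (Prefix (Send Ch_w (Data e)) (Prefix (Send Ch_m (Dir X))
          (sum_proc (\<lambda>f. Prefix (Recv Ch_r (Data f)) (Name (Ctrl t f))) (with_blank D)))))
       {(a, e, X, t). (s, d, a, e, X, t) \<in> rtm_trans M}"

definition E_fc :: "'d set \<Rightarrow> ('s, ('a, 'c, 'd) maction, 'd) rtm \<Rightarrow> ('s, 'a, 'c, 'd) mspec" where
  "E_fc D M = {(Ctrl s d,
       if s \<in> rtm_final M then Plus (ctrl_sum D M s d) One else ctrl_sum D M s d) | s d.
     s \<in> rtm_states M \<and> d \<in> with_blank D}"

lemma tape_eq_iff: "tape l d r = tape l' d' r' \<longleftrightarrow> blank_eq (l, d, r) (l', d', r')"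
  unfolding tape_def by (rule tape.abs_eq_iff)

lemma tape_pad_left: "tape (replicate i None @ l) d r = tape l d r"
proof -
  have "replicate 0 None @ (replicate i None @ l) = replicate i None @ l" by simp
  moreover have "r @ replicate 0 None = r @ replicate 0 None" by simp
  ultimately show ?thesis unfolding tape_eq_iff blank_eq.simps by blast
qed

lemma tape_pad_right: "tape l d (r @ replicate i None) = tape l d r"
proof -
  have "(r @ replicate i None) @ replicate 0 None = r @ replicate i None" by simp
  moreover have "replicate 0 None @ l = replicate 0 None @ l" by simp
  ultimately show ?thesis unfolding tape_eq_iff blank_eq.simps by blast
qed

lemma mark_last_pad_left: "mark_last (replicate i None @ l) r = mark_last l r"
proof (cases "l = []")
  case True
  have *: "tape (replicate k None) None r = tape [] None r" for k
    using tape_pad_left[of k "[]"] by simp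
  show ?thesis
    using True by (cases "i = 0") (simp_all add: mark_last_def butlast_conv_take *)
next
  case False
  thus ?thesis by (simp add: mark_last_def butlast_append tape_pad_left)
qed

lemma mark_last_pad_right: "mark_last l (r @ replicate i None) = mark_last l r"
  by (simp add: mark_last_def tape_pad_right)

lemma mark_first_pad_left: "mark_first (replicate i None @ l) r = mark_first l r"
  by (simp add: mark_first_def tape_pad_left)

lemma mark_first_pad_right: "mark_first l (r @ replicate i None) = mark_first l r"
proof (cases "r = []")
  case True
  have *: "tape l None (replicate k None) = tape l None []" for k
    using tape_pad_right[of l None "[]" k] by simp
  show ?thesis
    using True by (cases i) (auto simp: mark_first_def *)
next
  case False
  thus ?thesis by (simp add: mark_first_def tape_pad_right)
qed

lemma tape_rhs_cong:
  assumes "tape l d r = tape l' d' r'"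
  shows "tape_rhs D l d r = tape_rhs D l' d' r'"
proof -
  from assms obtain i j i' j' where
    l: "replicate i None @ l = replicate j None @ l'" and
    r: "r @ replicate i' None = r' @ replicate j' None" and d: "d = d'"
    by (auto simp: tape_eq_iff)
  have tp: "tape l e r = tape l' e r'" for e
    using tape_pad_left[of i l e r] tape_pad_left[of j l' e r]
      tape_pad_right[of l' e r i'] tape_pad_right[of l' e r' j'] l r by simp
  have ml: "mark_last l (d # r) = mark_last l' (d # r')"
    using mark_last_pad_left[of i l "d # r"] mark_last_pad_left[of j l' "d # r"]
      mark_last_pad_right[of l' "d # r" i'] mark_last_pad_right[of l' "d # r'" j'] l r by simp
  have mf: "mark_first (l @ [d]) r = mark_first (l' @ [d]) r'"
    using mark_first_pad_left[of i "l @ [d]" r] mark_first_pad_left[of j "l' @ [d]" r]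
      mark_first_pad_right[of "l' @ [d]" r i'] mark_first_pad_right[of "l' @ [d]" r' j'] l r
    by (simp flip: append_assoc)
  show ?thesis unfolding tape_rhs_def d[symmetric] tp ml mf ..
qed

lemma names_sum_list_proc: "names (sum_list_proc ps) = (\<Union>p\<in>set ps. names p)"
  by (induction ps rule: sum_list_proc.induct) auto

lemma names_sum_proc:
  assumes "finite I"
  shows "names (sum_proc f I) = (\<Union>i\<in>I. names (f i))"
proof -
  have "set (SOME xs. distinct xs \<and> set xs = I) = I"
    using someI_ex[of "\<lambda>xs. distinct xs \<and> set xs = I"] finite_distinct_list[OF assms] by blast
  thus ?thesis by (simp add: sum_proc_def names_sum_list_proc)
qed

lemma mark_last_tapes:
  "l \<in> lists (with_blank D) \<Longrightarrow> r \<in> lists (with_blank D) \<Longrightarrow> mark_last l r \<in> tapes D"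
  by (cases l rule: rev_cases) (auto simp: mark_last_def tapes_def with_blank_def)

lemma mark_first_tapes:
  "l \<in> lists (with_blank D) \<Longrightarrow> r \<in> lists (with_blank D) \<Longrightarrow> mark_first l r \<in> tapes D"
  by (cases r) (auto simp: mark_first_def tapes_def with_blank_def)

lemma Domain_E_tape: "Domain (E_tape D) = Tape ` tapes D"
  unfolding E_tape_def tapes_def by blast

lemma Domain_E_fc: "Domain (E_fc D M) = {Ctrl s d | s d. s \<in> rtm_states M \<and> d \<in> with_blank D}"
  unfolding E_fc_def by blast

lemma recursive_spec_E:
  assumes "finite A" "finite D" "is_rtm A D M"
  shows "recursive_spec (E_fc D M \<union> E_tape D)"
  unfolding recursive_spec_def
proof (intro conjI ballI)
  show "single_valued (E_fc D M \<union> E_tape D)"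
    by (auto simp: single_valued_def E_fc_def E_tape_def intro: tape_rhs_cong)
next
  have fin: "finite (with_blank D)" using assms by (simp add: with_blank_def)
  have sub: "rtm_trans M \<subseteq> rtm_states M \<times> with_blank D \<times> insert Tau A \<times> with_blank D \<times>
      {MoveL, MoveR} \<times> rtm_states M" and "finite (rtm_states M)"
    using assms(3) by (auto simp: is_rtm_def)
  have finI: "finite {(a, e, X, t). (s, d, a, e, X, t) \<in> rtm_trans M}" for s d
    by (rule finite_subset[of _ "insert Tau A \<times> with_blank D \<times> {MoveL, MoveR} \<times> rtm_states M"])
      (use sub fin assms \<open>finite (rtm_states M)\<close> in auto)
  have ctrl: "names (ctrl_sum D M s d) \<subseteq> Domain (E_fc D M)" for s d
    using sub unfolding ctrl_sum_def names_sum_proc[OF finI] Domain_E_fc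
    by (fastforce simp: names_sum_proc[OF fin])
  have tp: "names (tape_rhs D l d r) \<subseteq> Domain (E_tape D)"
    if "l \<in> lists (with_blank D)" "d \<in> with_blank D" "r \<in> lists (with_blank D)" for l d r
  proof -
    have "tape l e r \<in> tapes D" if "e \<in> with_blank D" for e
      using that \<open>l \<in> _\<close> \<open>r \<in> _\<close> unfolding tapes_def by blast
    moreover have "mark_last l (d # r) \<in> tapes D" "mark_first (l @ [d]) r \<in> tapes D"
      using that by (auto intro!: mark_last_tapes mark_first_tapes)
    ultimately show ?thesis
      using that(2) by (auto simp: tape_rhs_def Domain_E_tape names_sum_proc[OF fin])
  qed
  fix z assume "z \<in> E_fc D M \<union> E_tape D"
  thus "case z of (X, p) \<Rightarrow> names p \<subseteq> Domain (E_fc D M \<union> E_tape D)"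
  proof
    assume "z \<in> E_fc D M"
    then obtain s d where "z = (Ctrl s d,
        if s \<in> rtm_final M then Plus (ctrl_sum D M s d) One else ctrl_sum D M s d)"
      unfolding E_fc_def by blast
    thus ?thesis using ctrl[of s d] by auto
  next
    assume "z \<in> E_tape D"
    then obtain l d r where "z = (Tape (tape l d r), tape_rhs D l d r)"
      "l \<in> lists (with_blank D)" "d \<in> with_blank D" "r \<in> lists (with_blank D)"
      unfolding E_tape_def by blast
    thus ?thesis using tp[of l d r] by auto
  qed
qed

end

theory Submission
  imports Defs
begin

text \<open>One machine step is matched by the same action of the control followed by exactly three
  internal steps: write the symbol, move the head, read the new current symbol. Each of these
  three steps is the only one available, so all intermediate processes are related to the
  configuration that the machine has already reached, and the number of internal steps still to be
  made bounds the stuttering, which excludes spurious divergence.\<close>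

section \<open>Bisimulations with bounded deterministic stuttering\<close>

text \<open>The index counts the forced \<open>Tau\<close> steps that \<open>y\<close> still has to
  make while \<open>x\<close> stays put. At index 0 the two sides match step for step, so a step of
  \<open>T1\<close> is answered after the forced steps, and a forced step of \<open>T2\<close> is
  answered by standing still. A decreasing index cannot carry an infinite run.\<close>

lemma dpbb_stuttering:
  fixes sim :: "nat \<Rightarrow> 'p \<Rightarrow> 'q \<Rightarrow> bool"
    and T1 :: "('p, 'a, 'c, 'v) alts" and T2 :: "('q, 'a, 'c, 'v) alts"
  assumes states: "\<And>n x y. sim n x y \<Longrightarrow> x \<in> states T1 \<and> y \<in> states T2"
    and silent: "\<And>n x y. sim (Suc n) x y \<Longrightarrow>
      y \<notin> final T2 \<and> (\<exists>y'. sim n x y' \<and> (\<forall>a z. (y, a, z) \<in> trans T2 \<longleftrightarrow> a = Tau \<and> z = y'))"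
    and forward: "\<And>x y a x'. sim 0 x y \<Longrightarrow> (x, a, x') \<in> trans T1 \<Longrightarrow>
      \<exists>n y'. (y, a, y') \<in> trans T2 \<and> sim n x' y'"
    and backward: "\<And>x y a y'. sim 0 x y \<Longrightarrow> (y, a, y') \<in> trans T2 \<Longrightarrow>
      \<exists>n x'. (x, a, x') \<in> trans T1 \<and> sim n x' y'"
    and final: "\<And>x y. sim 0 x y \<Longrightarrow> x \<in> final T1 \<longleftrightarrow> y \<in> final T2"
  shows "dpbb T1 T2 {(x, y). \<exists>n. sim n x y}"
proof -
  let ?R = "{(x, y). \<exists>n. sim n x y}"
  have settle: "\<exists>y'. (y, y') \<in> (tau_rel T2)\<^sup>* \<and> sim 0 x y'" if "sim n x y" for n x y
    using that
  proof (induction n arbitrary: y)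
    case (Suc n)
    from silent[OF Suc.prems] obtain y1 where "sim n x y1" "(y, Tau, y1) \<in> trans T2" by blast
    with Suc.IH show ?case
      by (metis (mono_tags, lifting) CollectI case_prodI converse_rtrancl_into_rtrancl tau_rel_def)
  qed blast
  \<comment> \<open>The answer ends in a genuine transition rather than an \<open>opt_step\<close>;
    the divergence clause needs this to get a nonempty \<open>Tau\<close> path.\<close>
  have match: "\<exists>y'' y'. (y, y'') \<in> (tau_rel T2)\<^sup>* \<and> (y'', a, y') \<in> trans T2 \<and> (x, y'') \<in> ?R \<and>
      (x', y') \<in> ?R" if "(x, y) \<in> ?R" "(x, a, x') \<in> trans T1" for x y a x'
  proof -
    from that(1) settle obtain y'' where "(y, y'') \<in> (tau_rel T2)\<^sup>*" "sim 0 x y''" by blast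
    with forward[OF _ that(2)] show ?thesis by blast
  qed
  have half1: "dpbb_half T1 T2 ?R"
    unfolding dpbb_half_def
  proof (intro allI impI conjI)
    fix x y a x'
    assume "(x, y) \<in> ?R" "(x, a, x') \<in> trans T1"
    from match[OF this]
    show "\<exists>y'' y'. (y, y'') \<in> (tau_rel T2)\<^sup>* \<and> opt_step T2 y'' a y' \<and> (x, y'') \<in> ?R \<and>
        (x', y') \<in> ?R"
      unfolding opt_step_def by blast
  next
    fix x y
    assume "(x, y) \<in> ?R" "x \<in> final T1"
    thus "\<exists>y'. (y, y') \<in> (tau_rel T2)\<^sup>* \<and> y' \<in> final T2 \<and> (x, y') \<in> ?R"
      using settle final by blast
  next
    fix x y f
    assume "(x, y) \<in> ?R"
      and f: "f 0 = x \<and> (\<forall>i::nat. (f i, Tau, f (Suc i)) \<in> trans T1 \<and> (f i, y) \<in> ?R)"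
    \<comment> \<open>The first step of the divergent run suffices: its answer is a nonempty
      \<open>Tau\<close> path from \<open>y\<close> to a state related to
      \<open>f (Suc 0)\<close>.\<close>
    from f have "(f 0, y) \<in> ?R" "(f 0, Tau, f (Suc 0)) \<in> trans T1" by blast+
    from match[OF this] obtain y'' y' where
      "(y, y'') \<in> (tau_rel T2)\<^sup>*" "(y'', Tau, y') \<in> trans T2" and R: "(f (Suc 0), y') \<in> ?R"
      by blast
    hence "(y, y') \<in> (tau_rel T2)\<^sup>+"
      by (simp add: tau_rel_def rtrancl_into_trancl1)
    with R show "\<exists>y' i. (y, y') \<in> (tau_rel T2)\<^sup>+ \<and> (f i, y') \<in> ?R" by blast
  qed
  have half2: "dpbb_half T2 T1 (?R\<inverse>)"
    unfolding dpbb_half_def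
  proof (intro allI impI conjI)
    fix y x a y'
    assume "(y, x) \<in> ?R\<inverse>" and st: "(y, a, y') \<in> trans T2"
    then obtain n where n: "sim n x y" by blast
    have "\<exists>x'. opt_step T1 x a x' \<and> (\<exists>m. sim m x' y')"
    proof (cases n)
      case 0
      with n backward[OF _ st] show ?thesis unfolding opt_step_def by blast
    next
      case (Suc m)
      with silent[of m x y] n st have "a = Tau" "sim m x y'" by auto
      thus ?thesis unfolding opt_step_def by blast
    qed
    thus "\<exists>x'' x'. (x, x'') \<in> (tau_rel T1)\<^sup>* \<and> opt_step T1 x'' a x' \<and> (y, x'') \<in> ?R\<inverse> \<and>
        (y', x') \<in> ?R\<inverse>"
      using n by blast
  next
    fix y x
    assume "(y, x) \<in> ?R\<inverse>" and fin: "y \<in> final T2"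
    then obtain n where n: "sim n x y" by blast
    with silent fin have "n = 0" by (cases n) blast+
    with final n fin have "x \<in> final T1" by blast
    thus "\<exists>x'. (x, x') \<in> (tau_rel T1)\<^sup>* \<and> x' \<in> final T1 \<and> (y, x') \<in> ?R\<inverse>"
      using n by blast
  next
    fix y x f
    assume "(y, x) \<in> ?R\<inverse>"
      and f: "f 0 = y \<and> (\<forall>i::nat. (f i, Tau, f (Suc i)) \<in> trans T2 \<and> (f i, x) \<in> ?R\<inverse>)"
    \<comment> \<open>As long as the index is positive, the run has no choice but to take the forced
      step, which lowers the index with \<open>x\<close> fixed. So the run reaches index 0.\<close>
    have hit: "\<exists>j. sim 0 x (f j)" if "sim n x (f i)" for n i
      using that
    proof (induction n arbitrary: i)
      case (Suc n)
      from silent[OF Suc.prems] f have "sim n x (f (Suc i))" by metis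
      thus ?case by (rule Suc.IH)
    qed blast
    from f obtain n where "sim n x (f 0)" by blast
    from hit[OF this] obtain j where j: "sim 0 x (f j)" by blast
    \<comment> \<open>The run goes on beyond index 0, and there its step is mirrored by a real
      \<open>Tau\<close> step of \<open>x\<close>.\<close>
    from f have "(f j, Tau, f (Suc j)) \<in> trans T2" by blast
    from backward[OF j this] obtain x' m where "(x, Tau, x') \<in> trans T1" "sim m x' (f (Suc j))"
      by blast
    hence "(x, x') \<in> (tau_rel T1)\<^sup>+" "(f (Suc j), x') \<in> ?R\<inverse>"
      by (auto simp: tau_rel_def)
    thus "\<exists>x' i. (x, x') \<in> (tau_rel T1)\<^sup>+ \<and> (f i, x') \<in> ?R\<inverse>" by blast
  qed
  show ?thesis
    unfolding dpbb_def using half1 half2 states by auto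
qed

section \<open>Transitions of the process calculus\<close>

inductive_cases step_ZeroE: "step E Zero a q"
inductive_cases step_OneE: "step E One a q"
inductive_cases step_PrefixE: "step E (Prefix b p) a q"
inductive_cases step_PlusE: "step E (Plus p p') a q"
inductive_cases step_ParE: "step E (Par C p p') a q"
inductive_cases step_NameE: "step E (Name X) a q"
inductive_cases terminates_ZeroE: "terminates E Zero"
inductive_cases terminates_PrefixE: "terminates E (Prefix b p)"
inductive_cases terminates_PlusE: "terminates E (Plus p p')"
inductive_cases terminates_ParE: "terminates E (Par C p p')"
inductive_cases terminates_NameE: "terminates E (Name X)"

lemma step_Zero_iff [simp]: "step E Zero a q \<longleftrightarrow> False"
  by (blast elim: step_ZeroE)

lemma step_One_iff [simp]: "step E One a q \<longleftrightarrow> False"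
  by (blast elim: step_OneE)

lemma step_Prefix_iff [simp]: "step E (Prefix b p) a q \<longleftrightarrow> a = b \<and> q = p"
  by (blast elim: step_PrefixE intro: step_Prefix)

lemma step_Plus_iff [simp]: "step E (Plus p p') a q \<longleftrightarrow> step E p a q \<or> step E p' a q"
  by (blast elim: step_PlusE intro: step_PlusL step_PlusR)

lemma step_Name_iff: "step E (Name X) a q \<longleftrightarrow> (\<exists>p. (X, p) \<in> E \<and> step E p a q)"
  by (blast elim: step_NameE intro: step_Name)

lemma terminates_Zero_iff [simp]: "terminates E Zero \<longleftrightarrow> False"
  by (blast elim: terminates_ZeroE)

lemma terminates_One_iff [simp]: "terminates E One \<longleftrightarrow> True"
  by (simp add: term_One)

lemma terminates_Prefix_iff [simp]: "terminates E (Prefix b p) \<longleftrightarrow> False"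
  by (blast elim: terminates_PrefixE)

lemma terminates_Plus_iff [simp]:
  "terminates E (Plus p p') \<longleftrightarrow> terminates E p \<or> terminates E p'"
  by (blast elim: terminates_PlusE intro: term_PlusL term_PlusR)

lemma terminates_Par_iff [simp]:
  "terminates E (Par C p p') \<longleftrightarrow> terminates E p \<and> terminates E p'"
  by (blast elim: terminates_ParE intro: term_Par)

lemma terminates_Name_iff: "terminates E (Name X) \<longleftrightarrow> (\<exists>p. (X, p) \<in> E \<and> terminates E p)"
  by (blast elim: terminates_NameE intro: term_Name)

lemma step_sum_list_proc:
  "step E (sum_list_proc ps) a q \<longleftrightarrow> (\<exists>p\<in>set ps. step E p a q)"
  by (induction ps rule: sum_list_proc.induct) auto

lemma terminates_sum_list_proc:
  "terminates E (sum_list_proc ps) \<longleftrightarrow> (\<exists>p\<in>set ps. terminates E p)"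
  by (induction ps rule: sum_list_proc.induct) auto

text \<open>Finiteness supplies an enumeration, so the choice made in \<open>sum_proc\<close> really
  lists \<open>I\<close>.\<close>

lemma set_some_distinct:
  assumes "finite I"
  shows "set (SOME xs. distinct xs \<and> set xs = I) = I"
  using someI_ex[of "\<lambda>xs. distinct xs \<and> set xs = I"] finite_distinct_list[OF assms] by blast

lemma step_sum_proc:
  "finite I \<Longrightarrow> step E (sum_proc f I) a q \<longleftrightarrow> (\<exists>i\<in>I. step E (f i) a q)"
  by (simp add: sum_proc_def step_sum_list_proc set_some_distinct)

lemma terminates_sum_proc:
  "finite I \<Longrightarrow> terminates E (sum_proc f I) \<longleftrightarrow> (\<exists>i\<in>I. terminates E (f i))"
  by (simp add: sum_proc_def terminates_sum_list_proc set_some_distinct)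

lemma reachable_refl: "p \<in> reachable E p"
  by (simp add: reachable_def)

lemma reachable_step: "q \<in> reachable E p \<Longrightarrow> step E q a q' \<Longrightarrow> q' \<in> reachable E p"
  by (auto simp: reachable_def intro: rtrancl_into_rtrancl)

section \<open>Head movements\<close>

text \<open>One notation for both directions: \<open>e\<close> is the symbol left behind by the
  head, freshly written in a machine step and merely current in a pure move of the tape
  process.\<close>

fun shift :: "dir \<Rightarrow> 'd option list \<Rightarrow> 'd option \<Rightarrow> 'd option list \<Rightarrow> 'd tape" where
  "shift MoveL l e r = mark_last l (e # r)"
| "shift MoveR l e r = mark_first (l @ [e]) r"

lemma shift_tapes:
  assumes "l \<in> lists (with_blank D)" "e \<in> with_blank D" "r \<in> lists (with_blank D)"
  shows "shift X l e r \<in> tapes D"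
  using assms by (cases X) (auto intro!: mark_last_tapes mark_first_tapes)

lemma tape_replace:
  assumes "tape l d r = tape l' d' r'"
  shows "tape l e r = tape l' e r'"
  using assms by (simp add: tape_eq_iff)

text \<open>The right-hand side of a tape equation contains both shifted tapes, so that its
  well-definedness subsumes that of \<^const>\<open>shift\<close>.\<close>

lemma shift_cong:
  fixes l :: "'d option list"
  assumes "tape l d r = tape l' d' r'"
  shows "shift X l e r = shift X l' e r'"
proof -
  \<comment> \<open>The data set and the remaining types are arbitrary, since the summands for head
    moves do not depend on them; injectivity of the constructors then isolates the shifted
    tapes.\<close>
  have "(tape_rhs {} l e r :: (unit, unit, unit, 'd) mproc) = tape_rhs {} l' e r'"
    by (rule tape_rhs_cong[OF tape_replace[OF assms]])
  thus ?thesis by (cases X) (simp_all add: tape_rhs_def)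
qed

text \<open>A transition is given through some representative of the tape. Equal tapes carry the
  same marked symbol and have equal shifts, so any chosen representative will do.\<close>

lemma rtm_lts_trans_iff:
  assumes "l \<in> lists (with_blank D)" "r \<in> lists (with_blank D)"
  shows "((s, tape l d r), a, c) \<in> trans (rtm_lts D M) \<longleftrightarrow>
    (\<exists>e X t. (s, d, a, e, X, t) \<in> rtm_trans M \<and> c = (t, shift X l e r))"
    (is "?lhs \<longleftrightarrow> ?rhs")
proof
  assume ?lhs
  then obtain l' d' r' e X t where eq: "tape l d r = tape l' d' r'"
    and tr: "(s, d', a, e, X, t) \<in> rtm_trans M" and c: "c = (t, shift X l' e r')"
    unfolding rtm_lts_def by (fastforce simp: shift.simps[symmetric] simp del: shift.simps)
  from eq have "d' = d" by (simp add: tape_eq_iff)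
  with tr c shift_cong[OF eq] show ?rhs by metis
next
  assume ?rhs
  then obtain e X t where "(s, d, a, e, X, t) \<in> rtm_trans M" "c = (t, shift X l e r)" by blast
  with assms show ?lhs
    by (cases X) (simp add: rtm_lts_def del: in_lists_conv_set, blast)+
qed

section \<open>The simulation\<close>

abbreviation (input) tape_channels :: "'c channel set" where
  "tape_channels \<equiv> {Ch_r, Ch_w, Ch_m}"

text \<open>This and the next two definitions name, innermost first, what remains of a summand of
  \<open>ctrl_sum\<close> once its machine action has been performed.\<close>

definition ctrl_read :: "'d set \<Rightarrow> 's \<Rightarrow> ('s, 'a, 'c, 'd) mproc" where
  "ctrl_read D t =
     sum_proc (\<lambda>f. Prefix (Recv Ch_r (Data f)) (Name (Ctrl t f))) (with_blank D)"

definition ctrl_move :: "'d set \<Rightarrow> dir \<Rightarrow> 's \<Rightarrow> ('s, 'a, 'c, 'd) mproc" where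
  "ctrl_move D X t = Prefix (Send Ch_m (Dir X)) (ctrl_read D t)"

definition ctrl_write :: "'d set \<Rightarrow> 'd option \<Rightarrow> dir \<Rightarrow> 's \<Rightarrow> ('s, 'a, 'c, 'd) mproc" where
  "ctrl_write D e X t = Prefix (Send Ch_w (Data e)) (ctrl_move D X t)"

definition on_tape :: "('s, 'a, 'c, 'd) mproc \<Rightarrow> 'd tape \<Rightarrow> ('s, 'a, 'c, 'd) mproc" where
  "on_tape p \<delta> = Par tape_channels p (Name (Tape \<delta>))"

text \<open>The first argument is the number of internal steps until the control holds the symbol under
  the head again.\<close>

inductive rtm_sim ::
  "'d set \<Rightarrow> ('s, ('a, 'c, 'd) maction, 'd) rtm \<Rightarrow> nat \<Rightarrow> 's \<times> 'd tape \<Rightarrow>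
   ('s, 'a, 'c, 'd) mproc \<Rightarrow> bool"
  for D M where
  ready: "\<lbrakk>s \<in> rtm_states M; l \<in> lists (with_blank D); d \<in> with_blank D;
      r \<in> lists (with_blank D)\<rbrakk> \<Longrightarrow>
    rtm_sim D M 0 (s, tape l d r) (on_tape (Name (Ctrl s d)) (tape l d r))"
| reading: "\<lbrakk>s \<in> rtm_states M; \<delta> \<in> tapes D\<rbrakk> \<Longrightarrow>
    rtm_sim D M (Suc 0) (s, \<delta>) (on_tape (ctrl_read D s) \<delta>)"
| moving: "\<lbrakk>s \<in> rtm_states M; l \<in> lists (with_blank D); e \<in> with_blank D;
      r \<in> lists (with_blank D)\<rbrakk> \<Longrightarrow>
    rtm_sim D M (Suc (Suc 0)) (s, shift X l e r) (on_tape (ctrl_move D X s) (tape l e r))"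
| writing: "\<lbrakk>s \<in> rtm_states M; l \<in> lists (with_blank D); d \<in> with_blank D; e \<in> with_blank D;
      r \<in> lists (with_blank D)\<rbrakk> \<Longrightarrow>
    rtm_sim D M (Suc (Suc (Suc 0))) (s, shift X l e r)
      (on_tape (ctrl_write D e X s) (tape l d r))"

section \<open>Transitions of the control composed with the tape\<close>

locale reactive_turing_machine =
  fixes A :: "('a, 'c, 'd) maction set"
    and D :: "'d set"
    and M :: "('s, ('a, 'c, 'd) maction, 'd) rtm"
  assumes finite_A: "finite A"
    and no_comm: "A \<inter> comm_actions {Ch_r, Ch_w, Ch_m} = {}"
    and finite_D: "finite D"
    and rtm: "is_rtm A D M"
begin

abbreviation E :: "('s, 'a, 'c, 'd) mspec" where
  "E \<equiv> E_fc D M \<union> E_tape D"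

lemma finite_with_blank: "finite (with_blank D)"
  using finite_D by (simp add: with_blank_def)

text \<open>The bound on labels matters most: as neither \<open>Tau\<close> nor an action in
  \<open>A\<close> is a communication on the tape channels, machine actions pass freely through the
  parallel composition.\<close>

lemma rtm_transD:
  assumes "(s, d, a, e, X, t) \<in> rtm_trans M"
  shows "d \<in> with_blank D" "a \<notin> comm_actions tape_channels" "e \<in> with_blank D"
    "t \<in> rtm_states M"
proof -
  from rtm have "rtm_trans M \<subseteq> rtm_states M \<times> with_blank D \<times> insert Tau A \<times> with_blank D \<times>
      {MoveL, MoveR} \<times> rtm_states M"
    unfolding is_rtm_def by blast
  from subsetD[OF this assms] have a: "a \<in> insert Tau A"
    and "d \<in> with_blank D" "e \<in> with_blank D" "t \<in> rtm_states M"
    by simp_all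
  thus "d \<in> with_blank D" "e \<in> with_blank D" "t \<in> rtm_states M" by simp_all
  have "Tau \<notin> comm_actions tape_channels" by (simp add: comm_actions_def)
  with a no_comm show "a \<notin> comm_actions tape_channels" by blast
qed

lemma finite_rtm_trans: "finite {(a, e, X, t). (s, d, a, e, X, t) \<in> rtm_trans M}"
  by (rule finite_subset[of _ "insert Tau A \<times> with_blank D \<times> {MoveL, MoveR} \<times> rtm_states M"])
    (use rtm finite_A finite_with_blank in \<open>auto simp: is_rtm_def\<close>)

text \<open>All representatives of a tape yield the same right-hand side, so the equation can be
  read off at the given one.\<close>

lemma E_Tape:
  assumes "l \<in> lists (with_blank D)" "d \<in> with_blank D" "r \<in> lists (with_blank D)"
  shows "(Tape (tape l d r), p) \<in> E \<longleftrightarrow> p = tape_rhs D l d r"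
  using assms unfolding E_fc_def E_tape_def by (auto intro: tape_rhs_cong)

lemma step_tape:
  assumes "l \<in> lists (with_blank D)" "d \<in> with_blank D" "r \<in> lists (with_blank D)"
  shows "step E (Name (Tape (tape l d r))) b q \<longleftrightarrow>
    b = Send Ch_r (Data d) \<and> q = Name (Tape (tape l d r)) \<or>
    (\<exists>e\<in>with_blank D. b = Recv Ch_w (Data e) \<and> q = Name (Tape (tape l e r))) \<or>
    (\<exists>X. b = Recv Ch_m (Dir X) \<and> q = Name (Tape (shift X l d r)))"
proof -
  have ex_dir: "(\<exists>X. P X) \<longleftrightarrow> P MoveL \<or> P MoveR" for P by (metis dir.exhaust)
  show ?thesis
    unfolding step_Name_iff E_Tape[OF assms] simp_thms
    by (auto simp: tape_rhs_def step_sum_proc[OF finite_with_blank] ex_dir)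
qed

lemma terminates_tape:
  assumes "\<delta> \<in> tapes D"
  shows "terminates E (Name (Tape \<delta>))"
proof -
  from assms obtain l d r where "(Tape \<delta>, tape_rhs D l d r) \<in> E"
    unfolding tapes_def E_tape_def by blast
  moreover have "terminates E (tape_rhs D l d r)" by (simp add: tape_rhs_def)
  ultimately show ?thesis unfolding terminates_Name_iff by blast
qed

text \<open>The tape offers only communications on the three encapsulated channels and hence never
  moves alone. What remains is an independent step of the control or a handshake to read, write or
  move.\<close>

lemma step_on_tape:
  assumes "l \<in> lists (with_blank D)" "d \<in> with_blank D" "r \<in> lists (with_blank D)"
  shows "step E (on_tape p (tape l d r)) a z \<longleftrightarrow>
    (\<exists>p'. step E p a p' \<and> a \<notin> comm_actions tape_channels \<and> z = on_tape p' (tape l d r)) \<or>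
    a = Tau \<and>
     ((\<exists>p'. step E p (Recv Ch_r (Data d)) p' \<and> z = on_tape p' (tape l d r)) \<or>
      (\<exists>e\<in>with_blank D. \<exists>p'. step E p (Send Ch_w (Data e)) p' \<and> z = on_tape p' (tape l e r)) \<or>
      (\<exists>X p'. step E p (Send Ch_m (Dir X)) p' \<and> z = on_tape p' (shift X l d r)))"
    (is "?lhs \<longleftrightarrow> ?rhs")
proof
  assume ?lhs
  thus ?rhs
    unfolding on_tape_def
    by (cases rule: step_ParE) (auto simp: step_tape[OF assms] comm_actions_def)
next
  note tape = step_tape[OF assms, THEN iffD2]
  assume ?rhs
  thus ?lhs
    unfolding on_tape_def
    \<comment> \<open>The conclusion of a communication rule does not mention the channel, so each
      handshake has it supplied.\<close>
    by (elim disjE conjE exE bexE)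
      (auto intro: step_ParL step_CommL[where c = Ch_r] step_CommR[where c = Ch_w]
        step_CommR[where c = Ch_m] tape)
qed

lemma E_Ctrl:
  assumes "s \<in> rtm_states M" "d \<in> with_blank D"
  shows "(Ctrl s d, p) \<in> E \<longleftrightarrow>
    p = (if s \<in> rtm_final M then Plus (ctrl_sum D M s d) One else ctrl_sum D M s d)"
  using assms unfolding E_fc_def E_tape_def by auto

lemma step_ctrl:
  assumes "s \<in> rtm_states M" "d \<in> with_blank D"
  shows "step E (Name (Ctrl s d)) b q \<longleftrightarrow>
    (\<exists>e X t. (s, d, b, e, X, t) \<in> rtm_trans M \<and> q = ctrl_write D e X t)"
  unfolding step_Name_iff E_Ctrl[OF assms] simp_thms
  by (auto simp: ctrl_sum_def step_sum_proc[OF finite_rtm_trans] ctrl_write_def ctrl_move_def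
      ctrl_read_def)

lemma terminates_ctrl:
  assumes "s \<in> rtm_states M" "d \<in> with_blank D"
  shows "terminates E (Name (Ctrl s d)) \<longleftrightarrow> s \<in> rtm_final M"
  unfolding terminates_Name_iff E_Ctrl[OF assms] simp_thms
  by (auto simp: ctrl_sum_def terminates_sum_proc[OF finite_rtm_trans])

text \<open>A waiting control offers only machine labels, none of which is a tape communication, so
  every handshake case is void.\<close>

lemma step_ready:
  assumes "s \<in> rtm_states M" "l \<in> lists (with_blank D)" "d \<in> with_blank D"
    "r \<in> lists (with_blank D)"
  shows "step E (on_tape (Name (Ctrl s d)) (tape l d r)) a z \<longleftrightarrow>
    (\<exists>e X t. (s, d, a, e, X, t) \<in> rtm_trans M \<and> z = on_tape (ctrl_write D e X t) (tape l d r))"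
  using rtm_transD(2)
  unfolding step_on_tape[OF assms(2-4)] step_ctrl[OF assms(1,3)]
  by (fastforce simp: comm_actions_def)

section \<open>The bisimulation conditions for machine configurations\<close>

lemma rtm_sim_states:
  assumes "rtm_sim D M n c p"
  shows "c \<in> states (rtm_lts D M)"
  using assms by cases (auto simp: rtm_lts_def shift_tapes, auto simp: tapes_def)

text \<open>Each intermediate control begins with communications only, so it neither acts alone nor
  terminates, although the tape always may.\<close>

lemma rtm_sim_silent:
  assumes "rtm_sim D M (Suc n) c p"
  shows "\<not> terminates E p \<and> (\<exists>p'. rtm_sim D M n c p' \<and> (\<forall>a z. step E p a z \<longleftrightarrow> a = Tau \<and> z = p'))"
  using assms
proof cases
  case (reading s \<delta>)
  then obtain l d r where ldr: "l \<in> lists (with_blank D)" "d \<in> with_blank D"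
    "r \<in> lists (with_blank D)" and \<delta>: "\<delta> = tape l d r"
    unfolding tapes_def by blast
  \<comment> \<open>The control is ready to receive any symbol, but the tape sends only
    \<open>d\<close>, which singles out one summand.\<close>
  have "step E p a z \<longleftrightarrow> a = Tau \<and> z = on_tape (Name (Ctrl s d)) \<delta>" for a z
    using ldr reading(3)
    by (auto simp: \<delta> step_on_tape ctrl_read_def step_sum_proc[OF finite_with_blank]
        comm_actions_def)
  moreover have "rtm_sim D M n c (on_tape (Name (Ctrl s d)) \<delta>)"
    using reading ldr unfolding \<delta> by (auto intro: rtm_sim.ready)
  moreover have "\<not> terminates E p"
    using reading(3)
    by (simp add: on_tape_def ctrl_read_def terminates_sum_proc[OF finite_with_blank])
  ultimately show ?thesis by blast
next
  case (moving s l e r X)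
  have "step E p a z \<longleftrightarrow> a = Tau \<and> z = on_tape (ctrl_read D s) (shift X l e r)" for a z
    using moving by (auto simp: step_on_tape ctrl_move_def comm_actions_def)
  moreover have "rtm_sim D M n c (on_tape (ctrl_read D s) (shift X l e r))"
    using moving by (auto intro!: rtm_sim.reading shift_tapes)
  moreover have "\<not> terminates E p"
    using moving by (simp add: on_tape_def ctrl_move_def)
  ultimately show ?thesis by blast
next
  case (writing s l d e r X)
  have "step E p a z \<longleftrightarrow> a = Tau \<and> z = on_tape (ctrl_move D X s) (tape l e r)" for a z
    using writing by (auto simp: step_on_tape ctrl_write_def comm_actions_def)
  moreover have "rtm_sim D M n c (on_tape (ctrl_move D X s) (tape l e r))"
    using writing by (auto intro!: rtm_sim.moving)
  moreover have "\<not> terminates E p"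
    using writing by (simp add: on_tape_def ctrl_write_def)
  ultimately show ?thesis by blast
qed

text \<open>The control performs the machine's label first, so the answer is immediate; write, move
  and read stay pending, whence index 3.\<close>

lemma rtm_sim_forth:
  assumes "rtm_sim D M 0 c p" "(c, a, c') \<in> trans (rtm_lts D M)"
  shows "\<exists>n p'. step E p a p' \<and> rtm_sim D M n c' p'"
  using assms(1)
proof cases
  case (ready s l d r)
  with assms(2) obtain e X t where tr: "(s, d, a, e, X, t) \<in> rtm_trans M"
    and c': "c' = (t, shift X l e r)"
    by (auto simp: rtm_lts_trans_iff)
  with ready have "step E p a (on_tape (ctrl_write D e X t) (tape l d r))"
    by (auto simp: step_ready)
  moreover have "rtm_sim D M (Suc (Suc (Suc 0))) c' (on_tape (ctrl_write D e X t) (tape l d r))"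
    using ready rtm_transD[OF tr] unfolding c' by (auto intro!: rtm_sim.writing)
  ultimately show ?thesis by blast
qed

lemma rtm_sim_back:
  assumes "rtm_sim D M 0 c p" "step E p a p'"
  shows "\<exists>n c'. (c, a, c') \<in> trans (rtm_lts D M) \<and> rtm_sim D M n c' p'"
  using assms(1)
proof cases
  case (ready s l d r)
  with assms(2) obtain e X t where tr: "(s, d, a, e, X, t) \<in> rtm_trans M"
    and p': "p' = on_tape (ctrl_write D e X t) (tape l d r)"
    by (auto simp: step_ready)
  with ready have "(c, a, (t, shift X l e r)) \<in> trans (rtm_lts D M)"
    by (auto simp: rtm_lts_trans_iff)
  moreover have "rtm_sim D M (Suc (Suc (Suc 0))) (t, shift X l e r) p'"
    using ready rtm_transD[OF tr] unfolding p' by (auto intro!: rtm_sim.writing)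
  ultimately show ?thesis by blast
qed

text \<open>Every tape process terminates, so termination is decided by the control alone.\<close>

lemma rtm_sim_final:
  assumes "rtm_sim D M 0 c p"
  shows "c \<in> final (rtm_lts D M) \<longleftrightarrow> terminates E p"
  using assms
proof cases
  case (ready s l d r)
  hence "tape l d r \<in> tapes D" unfolding tapes_def by blast
  with ready terminates_tape show ?thesis
    by (simp add: on_tape_def terminates_ctrl rtm_lts_def)
qed

text \<open>Conjoining reachability keeps the relation within the states of \<open>proc_lts\<close>;
  it is preserved because reachable processes are closed under steps.\<close>

lemma dpbb_rtm_sim:
  "dpbb (rtm_lts D M) (proc_lts E p0) {(c, p). \<exists>n. rtm_sim D M n c p \<and> p \<in> reachable E p0}"
proof (rule dpbb_stuttering, goal_cases)
  case (1 n x y)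
  thus ?case using rtm_sim_states[of n x y] by (simp add: proc_lts_def)
next
  case (2 n x y)
  hence "y \<in> reachable E p0" by blast
  moreover from 2 rtm_sim_silent[of n x y] obtain y' where y': "rtm_sim D M n x y'"
    "\<And>a z. step E y a z \<longleftrightarrow> a = Tau \<and> z = y'" "\<not> terminates E y" by blast
  moreover from calculation have "y' \<in> reachable E p0" using reachable_step by blast
  ultimately show ?case by (auto simp: proc_lts_def)
next
  case (3 x y a x')
  thus ?case using rtm_sim_forth[of x y a x'] reachable_step by (fastforce simp: proc_lts_def)
next
  case (4 x y a y')
  thus ?case using rtm_sim_back[of x y a y'] reachable_step by (fastforce simp: proc_lts_def)
next
  case (5 x y)
  thus ?case using rtm_sim_final[of x y] by (simp add: proc_lts_def)
qed

end

theorem theorem5: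
  fixes A :: "('a, 'c, 'd) maction set"
    and D :: "'d set"
    and M :: "('s, ('a, 'c, 'd) maction, 'd) rtm"
  assumes "finite A"
    and "Tau \<notin> A"
    and "A \<inter> comm_actions {Ch_r, Ch_w, Ch_m} = {}"
    and "finite D"
    and "is_rtm A D M"
  shows "rtm_lts D M \<leftrightarrow>\<^sub>b\<^sup>\<Delta>
    proc_lts (E_fc D M \<union> E_tape D)
      (Par {Ch_r, Ch_w, Ch_m}
        (Name (Ctrl (rtm_init M) None)) (Name (Tape (tape [] None []))))"
proof -
  interpret reactive_turing_machine A D M
    using assms by unfold_locales
  let ?p0 = "on_tape (Name (Ctrl (rtm_init M) None)) (tape [] None [])"
  \<comment> \<open>The control starts out holding the blank under the head, so no silent step is
    pending.\<close>
  have "rtm_sim D M 0 (rtm_init M, tape [] None []) ?p0"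
    using rtm by (intro rtm_sim.ready) (auto simp: is_rtm_def with_blank_def)
  hence "(init (rtm_lts D M), init (proc_lts E ?p0)) \<in>
      {(c, p). \<exists>n. rtm_sim D M n c p \<and> p \<in> reachable E ?p0}"
    by (auto simp: rtm_lts_def proc_lts_def reachable_refl)
  with dpbb_rtm_sim[of ?p0] show ?thesis
    unfolding dpbb_equiv_def on_tape_def by blast
qed

end
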